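(* Let the network $f(x,\theta)$, inputs $x_1,\dots,x_N\in\mathbb{R}$, labels $y\in\mathbb{R}^N$ and the vectorized network $f(\theta)\in\mathbb{R}^N$ be as in the context, and let $\mu>0$. Let the parameters $\theta(t)\in\mathbb{R}^p$ evolve by the Levenberg--Marquardt (LM) preconditioned continuous gradient flow $$\frac{\partial\theta}{\partial t}=-(\mu I+J_t^TJ_t)^{-1}J_t^T\,e(t),$$ where $J_t=\nabla_\theta f(\theta(t))\in\mathbb{R}^{N\times p}$ is the Jacobian and $e(t)=f(\theta(t))-y$ is the error, so that $\frac{\partial}{\partial t}e=-J_t(\mu I+J_t^TJ_t)^{-1}J_t^Te$. Let $K_t=J_tJ_t^T\in\mathbb{R}^{N\times N}$, let $\Lambda=\mathrm{diag}(\lambda_i)\ge 0$ be the eigenvalues of $K_t$, written $\lambda_i=\lambda_i(e)$, and for $1\le i\le N$ let $\hat e_i(t)$ be the error coefficient associated with the $i$th eigenvector of $K_t$ (the coefficient of $e(t)$ along the $i$th vector of an orthonormal basis of eigenvectors of $K_t$). Then the LM-preconditioned continuous gradient flow of $\hat e_i$ takes the form $$\frac{\partial}{\partial t}\hat e_i=-\frac{\lambda_i(e)}{\mu+\lambda_i(e)}\,\hat e_i .$$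
   Context: Network: $f(x,\theta):\mathbb{R}\times\mathbb{R}^p\to\mathbb{R}$ is a multilayer perceptron of depth $L$ and constant width $W$, $$f(x,\theta)=\theta^{(L)}\sigma\Big(\tfrac{1}{\sqrt W}\theta^{(L-1)}\sigma\big(\cdots\sigma\big(\tfrac{1}{\sqrt W}\theta^{(1)}x+\beta b^{(1)}\big)\cdots\big)+\beta b^{(L-1)}\Big)+\beta b^{(L)},$$ where $\sigma$ is an activation function applied entrywise, $\beta$ is a fixed constant, and $\theta\in\mathbb{R}^p$ collects the network parameters. The initialization and scaling of the weights are those of the standard neural tangent kernel (NTK) parametrization of Jacot et al. (2018). Data and loss: $f(\theta)=(f(x_1,\theta),\dots,f(x_N,\theta))^T\in\mathbb{R}^N$, and the loss is $\mathcal{L}(\theta)=\frac12\|f(\theta)-y\|^2$. The LM flow is the continuous-time (step size $\eta\to0$) version of $\theta_{n+1}=\theta_n-\eta(\mu I+J^TJ)^{-1}J^T(f(\theta_n)-y)$, with $J$ the Jacobian at $\theta_n$. The matrix $K_t$ is the time-dependent NTK matrix; it is symmetric positive semidefinite and has an orthogonal basis of eigenvectors. The notation $\lambda_i(e)$ records that $K_t$, its eigenvalues and its basis of eigenmodes evolve nonlinearly with $e$ (they are not assumed constant in time).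
   Formalization: The time derivative of the i-th error coefficient is taken with the eigenbasis of K_t held fixed at time t (the component of de/dt along the i-th eigenvector); with a moving eigenbasis the stated equation is false in general because of an extra term from the rotating eigenvectors. *)

theory Defs
  imports "HOL-Analysis.Analysis"
begin

text \<open>Layers are numbered \<open>1..L\<close>, units within a layer from \<open>0\<close>.
  \<open>Weight l i j\<close> names the entry \<open>(i, j)\<close> of the matrix of layer \<open>l\<close>,
  \<open>Bias l i\<close> the entry \<open>i\<close> of its bias vector.\<close>

datatype param = Weight nat nat nat | Bias nat nat

definition fan_in :: "nat \<Rightarrow> nat \<Rightarrow> nat" where
  "fan_in W l = (if l = 1 then 1 else W)"

definition fan_out :: "nat \<Rightarrow> nat \<Rightarrow> nat \<Rightarrow> nat" where
  "fan_out L W l = (if l = L then 1 else W)"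

definition params :: "nat \<Rightarrow> nat \<Rightarrow> param set" where
  "params L W =
     {Weight l i j | l i j. l \<in> {1..L} \<and> i < fan_out L W l \<and> j < fan_in W l} \<union>
     {Bias l i | l i. l \<in> {1..L} \<and> i < fan_out L W l}"

text \<open>Activations of layer \<open>l\<close>; layer \<open>0\<close> is the scalar input, read at unit \<open>0\<close> only.\<close>

fun hidden :: "nat \<Rightarrow> (real \<Rightarrow> real) \<Rightarrow> real \<Rightarrow> (param \<Rightarrow> real) \<Rightarrow> real \<Rightarrow> nat \<Rightarrow> nat \<Rightarrow> real" where
  "hidden W \<sigma> \<beta> q x 0 i = x"
| "hidden W \<sigma> \<beta> q x (Suc l) i =
     \<sigma> (1 / sqrt (real W) * (\<Sum>j<fan_in W (Suc l). q (Weight (Suc l) i j) * hidden W \<sigma> \<beta> q x l j)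
        + \<beta> * q (Bias (Suc l) i))"

text \<open>The last layer is affine and carries no factor \<open>1 / sqrt W\<close>. Meant for \<open>L \<ge> 2\<close>.\<close>

definition mlp :: "nat \<Rightarrow> nat \<Rightarrow> (real \<Rightarrow> real) \<Rightarrow> real \<Rightarrow> (param \<Rightarrow> real) \<Rightarrow> real \<Rightarrow> real" where
  "mlp L W \<sigma> \<beta> q x =
     (\<Sum>j<fan_in W L. q (Weight L 0 j) * hidden W \<sigma> \<beta> q x (L - 1) j) + \<beta> * q (Bias L 0)"

text \<open>The parameters form one vector \<open>\<theta>\<close>, whose coordinates are matched with the parameter
  names by \<open>pos\<close> (a bijection from \<open>params L W\<close>, so that \<open>CARD('p)\<close> is the number of
  parameters). The inputs are indexed by the finite type \<open>'n\<close>.\<close>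

definition net ::
  "nat \<Rightarrow> nat \<Rightarrow> (real \<Rightarrow> real) \<Rightarrow> real \<Rightarrow> (param \<Rightarrow> 'p) \<Rightarrow> ('n \<Rightarrow> real) \<Rightarrow> real ^ 'p::finite \<Rightarrow> real ^ 'n::finite" where
  "net L W \<sigma> \<beta> pos x \<theta> = (\<chi> i. mlp L W \<sigma> \<beta> (\<lambda>q. \<theta> $ pos q) (x i))"

definition lm_precond :: "real \<Rightarrow> real ^ 'p ^ 'n \<Rightarrow> real ^ 'n ^ 'p" where
  "lm_precond \<mu> J = matrix_inv (\<mu> *\<^sub>R mat 1 + transpose J ** J) ** transpose J"

definition ntk :: "real ^ 'p ^ 'n \<Rightarrow> real ^ 'n ^ 'n" where
  "ntk J = J ** transpose J"

text \<open>An orthonormal family of eigenvectors indexed by \<open>'n\<close> itself is a basis of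
  \<open>real ^ 'n\<close>; \<open>lam\<close> lists the eigenvalues with multiplicity.\<close>

definition orthonormal_eigenbasis ::
  "real ^ 'n ^ 'n \<Rightarrow> ('n \<Rightarrow> real ^ 'n) \<Rightarrow> ('n \<Rightarrow> real) \<Rightarrow> bool" where
  "orthonormal_eigenbasis K v lam \<longleftrightarrow>
     (\<forall>i j. v i \<bullet> v j = (if i = j then 1 else 0)) \<and>
     (\<forall>i. K *v v i = lam i *\<^sub>R v i)"

text \<open>Coefficient of \<open>u\<close> along the \<open>i\<close>-th eigenmode at time \<open>t\<close>. The flow of the error
  coefficients at time \<open>t\<close> is the derivative at \<open>s = t\<close> of \<open>mode_coeff V t (e s) i\<close>, that is,
  the time derivative of the error expressed in the eigenbasis of the kernel at time \<open>t\<close>.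
  Differentiating \<open>mode_coeff V s (e s) i\<close> instead would add the inner product of the error
  with the derivative of \<open>\<lambda>s. V s i\<close>, which does not vanish in general.\<close>

definition mode_coeff :: "(real \<Rightarrow> 'n \<Rightarrow> real ^ 'n) \<Rightarrow> real \<Rightarrow> real ^ 'n \<Rightarrow> 'n::finite \<Rightarrow> real" where
  "mode_coeff V t u i = V t i \<bullet> u"

end

theory Submission
  imports Defs
begin

text \<open>The push-through identity \<open>(\<mu> I + J\<^sup>T J) J\<^sup>T = J\<^sup>T (\<mu> I + J J\<^sup>T)\<close> makes \<open>J\<^sup>T\<close> map each
  eigenvector of the kernel \<open>J J\<^sup>T\<close> with eigenvalue \<open>\<lambda>\<close> to an eigenvector of the damped
  Gauss--Newton matrix \<open>\<mu> I + J\<^sup>T J\<close> with eigenvalue \<open>\<mu> + \<lambda>\<close>. As the latter matrix is symmetric,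
  pairing the velocity of the error with a kernel eigenvector yields the factor \<open>\<lambda> / (\<mu> + \<lambda>)\<close>;
  the velocity itself comes from the chain rule.\<close>

lemma damped_gram_mult_vector:
  fixes J :: "real ^ 'p ^ 'n"
  shows "(\<mu> *\<^sub>R mat 1 + transpose J ** J) *v w = \<mu> *\<^sub>R w + transpose J *v (J *v w)"
  by (simp add: matrix_vector_mult_add_rdistrib scaleR_matrix_vector_assoc [symmetric]
      matrix_vector_mul_assoc)

lemma inner_matrix_vector_transpose:
  fixes A :: "real ^ 'p ^ 'n"
  shows "u \<bullet> (A *v w) = (transpose A *v u) \<bullet> w"
  by (simp add: dot_lmul_matrix)

text \<open>For \<open>w\<close> in the kernel, pairing with \<open>w\<close> gives 0 = \<mu> |w|^2
  + |J w|^2, so \<mu> > 0 forces \<open>w = 0\<close>; a square matrix with trivial kernel is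
  invertible.\<close>

lemma invertible_damped_gram:
  fixes J :: "real ^ 'p ^ 'n"
  assumes "\<mu> > 0"
  shows "invertible (\<mu> *\<^sub>R mat 1 + transpose J ** J)"
proof -
  have "w = 0" if w: "(\<mu> *\<^sub>R mat 1 + transpose J ** J) *v w = 0" for w
  proof -
    have "0 = w \<bullet> (\<mu> *\<^sub>R w + transpose J *v (J *v w))"
      using w by (simp add: damped_gram_mult_vector)
    also have "\<dots> = \<mu> * (w \<bullet> w) + (J *v w) \<bullet> (J *v w)"
      by (simp only: inner_add_right inner_scaleR_right inner_matrix_vector_transpose
          transpose_transpose)
    finally have "\<mu> * (w \<bullet> w) \<le> 0"
      by (metis add.commute inner_ge_zero le_add_same_cancel2)
    with assms show "w = 0"
      by (metis inner_gt_zero_iff mult_pos_pos not_le)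
  qed
  then show ?thesis
    by (simp add: invertible_left_inverse matrix_left_invertible_ker)
qed

text \<open>Records the preconditioned vector as the solution of a linear system, so that later
  arguments need not handle \<open>matrix_inv\<close>.\<close>

lemma lm_precond_solves:
  fixes J :: "real ^ 'p ^ 'n"
  assumes "\<mu> > 0"
  shows "\<mu> *\<^sub>R (lm_precond \<mu> J *v u) + transpose J *v (J *v (lm_precond \<mu> J *v u)) =
    transpose J *v u"
proof -
  let ?A = "\<mu> *\<^sub>R mat 1 + transpose J ** J"
  have "?A ** lm_precond \<mu> J = transpose J"
    \<comment> \<open>\<open>matrix_inv\<close> is a Hilbert choice; invertibility supplies the
      existence that makes the chosen matrix a genuine two-sided inverse.\<close>
    using invertible_damped_gram [OF assms, of J, unfolded invertible_def]
      someI_ex [of "\<lambda>B. ?A ** B = mat 1 \<and> B ** ?A = mat 1", folded matrix_inv_def]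
    by (simp add: lm_precond_def matrix_mul_assoc)
  then show ?thesis
    by (metis damped_gram_mult_vector matrix_vector_mul_assoc)
qed

text \<open>Pairing the eigenvalue equation with \<open>v\<close> gives l |v|^2 = |J^T v|^2.\<close>

lemma ntk_eigenvalue_nonneg:
  fixes J :: "real ^ 'p ^ 'n"
  assumes "ntk J *v v = l *\<^sub>R v" and "v \<noteq> 0"
  shows "0 \<le> l"
proof -
  have "l * (v \<bullet> v) = v \<bullet> (J *v (transpose J *v v))"
    using assms(1) by (metis inner_scaleR_right matrix_vector_mul_assoc ntk_def)
  also have "\<dots> = (transpose J *v v) \<bullet> (transpose J *v v)"
    by (rule inner_matrix_vector_transpose)
  finally have "0 \<le> l * (v \<bullet> v)"
    by simp
  with \<open>v \<noteq> 0\<close> show ?thesis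
    by (metis inner_gt_zero_iff mult_neg_pos not_le)
qed

text \<open>The linear system for \<open>w\<close> is tested against z = J^T v. The sign condition
  on \<open>l\<close> keeps \<mu> + l positive, so the final division is legitimate.\<close>

lemma inner_ntk_eigenvector_lm_precond:
  fixes J :: "real ^ 'p ^ 'n"
  assumes "\<mu> > 0" and "0 \<le> l" and eig: "ntk J *v v = l *\<^sub>R v"
  shows "v \<bullet> ((J ** lm_precond \<mu> J) *v u) = l / (\<mu> + l) * (v \<bullet> u)"
proof -
  define w where "w = lm_precond \<mu> J *v u"
  define z where "z = transpose J *v v"
  have Jz: "J *v z = l *\<^sub>R v"
    using eig by (simp only: z_def ntk_def matrix_vector_mul_assoc)
  have "l * (v \<bullet> u) = (J *v z) \<bullet> u"
    by (simp add: Jz)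
  also have "\<dots> = z \<bullet> (transpose J *v u)"
    by (simp only: inner_matrix_vector_transpose transpose_transpose)
  also have "\<dots> = z \<bullet> (\<mu> *\<^sub>R w + transpose J *v (J *v w))"
    using lm_precond_solves [OF \<open>\<mu> > 0\<close>, of J u] by (simp only: w_def)
  also have "\<dots> = \<mu> * (z \<bullet> w) + (J *v z) \<bullet> (J *v w)"
    by (simp only: inner_add_right inner_scaleR_right inner_matrix_vector_transpose
        transpose_transpose)
  \<comment> \<open>Moving J^T across turns \<open>z \<bullet> w\<close> into
    \<open>v \<bullet> (J *v w)\<close>, which gives the share \<mu>; the share \<open>l\<close>
    comes from \<open>Jz\<close>.\<close>
  also have "\<dots> = (\<mu> + l) * (v \<bullet> (J *v w))"
    unfolding Jz inner_scaleR_left distrib_right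
    by (simp only: z_def inner_matrix_vector_transpose)
  finally have "(\<mu> + l) * (v \<bullet> (J *v w)) = l * (v \<bullet> u)" ..
  moreover have "v \<bullet> ((J ** lm_precond \<mu> J) *v u) = v \<bullet> (J *v w)"
    by (simp add: w_def matrix_vector_mul_assoc)
  ultimately show ?thesis
    using assms(1,2) by (simp add: field_simps)
qed

text \<open>The outer map is differentiated in the full space and only the curve within
  \<open>T\<close>, so one-sided derivatives at endpoints of a time interval are covered.\<close>

lemma has_vector_derivative_jacobian_chain:
  fixes f :: "real ^ 'p \<Rightarrow> real ^ 'n"
  assumes "f differentiable (at (g t))" and g: "(g has_vector_derivative g') (at t within T)"
  shows "((\<lambda>s. f (g s)) has_vector_derivative jacobian f (at (g t)) *v g') (at t within T)"
proof -
  have "(f has_derivative (\<lambda>h. jacobian f (at (g t)) *v h)) (at (g t))"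
    using assms(1) by (simp add: jacobian_works)
  from has_derivative_compose [OF g [unfolded has_vector_derivative_def] this]
  show ?thesis
    by (simp add: has_vector_derivative_def matrix_vector_mult_scaleR)
qed

theorem lemma3p2:
  fixes L W :: nat and \<sigma> :: "real \<Rightarrow> real" and \<beta> \<mu> :: real
    and pos :: "param \<Rightarrow> 'p::finite"
    and x :: "'n::finite \<Rightarrow> real" and y :: "real ^ 'n"
    and T :: "real set" and \<theta> :: "real \<Rightarrow> real ^ 'p"
    and f :: "real ^ 'p \<Rightarrow> real ^ 'n" and e :: "real \<Rightarrow> real ^ 'n"
    and J :: "real \<Rightarrow> real ^ 'p ^ 'n" and K :: "real \<Rightarrow> real ^ 'n ^ 'n"
    and V :: "real \<Rightarrow> 'n \<Rightarrow> real ^ 'n" and lam :: "real \<Rightarrow> 'n \<Rightarrow> real"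
  assumes "L \<ge> 2" and "W \<ge> 1" and "\<mu> > 0"
    and "bij_betw pos (params L W) UNIV"
    and "is_interval T"
    and "f = net L W \<sigma> \<beta> pos x"
    and "\<And>t. t \<in> T \<Longrightarrow> f differentiable (at (\<theta> t))"
    and "\<And>t. J t = jacobian f (at (\<theta> t))"
    and "\<And>t. e t = f (\<theta> t) - y"
    and "\<And>t. K t = ntk (J t)"
    and "\<And>t. t \<in> T \<Longrightarrow>
           (\<theta> has_vector_derivative - (lm_precond \<mu> (J t) *v e t)) (at t within T)"
    and "\<And>t. t \<in> T \<Longrightarrow> orthonormal_eigenbasis (K t) (V t) (lam t)"
  shows "\<forall>t\<in>T.
           (e has_vector_derivative - ((J t ** lm_precond \<mu> (J t)) *v e t)) (at t within T) \<and>
           (\<forall>i. 0 \<le> lam t i \<and>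
              ((\<lambda>s. mode_coeff V t (e s) i) has_real_derivative
                 - (lam t i / (\<mu> + lam t i)) * mode_coeff V t (e t) i) (at t within T))"
proof
  fix t assume t: "t \<in> T"
  have "((\<lambda>s. f (\<theta> s)) has_vector_derivative J t *v - (lm_precond \<mu> (J t) *v e t)) (at t within T)"
    using has_vector_derivative_jacobian_chain assms(7) [OF t] assms(11) [OF t]
    by (simp only: assms(8))
  moreover have "e = (\<lambda>s. f (\<theta> s) - y)"
    using assms(9) by auto
  ultimately have e:
    "(e has_vector_derivative - ((J t ** lm_precond \<mu> (J t)) *v e t)) (at t within T)"
    by (simp add: has_vector_derivative_diff_const vec.neg matrix_vector_mul_assoc)
  have "0 \<le> lam t i \<and>
      ((\<lambda>s. mode_coeff V t (e s) i) has_real_derivative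
        - (lam t i / (\<mu> + lam t i)) * mode_coeff V t (e t) i) (at t within T)" for i
  proof
    have eig: "ntk (J t) *v V t i = lam t i *\<^sub>R V t i" and "V t i \<bullet> V t i = 1"
      using assms(12) [OF t] by (simp_all add: orthonormal_eigenbasis_def assms(10))
    then have "V t i \<noteq> 0"
      by auto
    with eig show lam: "0 \<le> lam t i"
      by (rule ntk_eigenvalue_nonneg)
    \<comment> \<open>The eigenvector is frozen at time \<open>t\<close>, so the coefficient is a
      fixed bounded linear functional of \<open>e s\<close> and no derivative of \<open>V\<close>
      arises.\<close>
    from bounded_linear.has_vector_derivative [OF bounded_linear_inner_right [of "V t i"] e]
    show "((\<lambda>s. mode_coeff V t (e s) i) has_real_derivative
        - (lam t i / (\<mu> + lam t i)) * mode_coeff V t (e t) i) (at t within T)"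
      by (simp add: mode_coeff_def has_real_derivative_iff_has_vector_derivative
          inner_ntk_eigenvector_lm_precond [OF \<open>\<mu> > 0\<close> lam eig])
  qed
  with e show "(e has_vector_derivative - ((J t ** lm_precond \<mu> (J t)) *v e t)) (at t within T) \<and>
      (\<forall>i. 0 \<le> lam t i \<and>
        ((\<lambda>s. mode_coeff V t (e s) i) has_real_derivative
          - (lam t i / (\<mu> + lam t i)) * mode_coeff V t (e t) i) (at t within T))"
    by blast
qed

end
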